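(* Under the structural and entropy assumptions listed in the context, let $u=u(t,x)\in\omega$ be a smooth solution of the limiting system $$\partial_t u=-\partial_x\big(QA(\mathcal{E}(u))\,U_1\big),$$ where $U_1=U_1(t,x)\in\mathbb{R}^N$ is the unique solution of $$B(\mathcal{E}(u))\,U_1=-\partial_xF(\mathcal{E}(u)),\qquad QU_1=0 .$$ Then the entropy is non-increasing in the following sense: $$\partial_t\Phi(\mathcal{E}(u))\ \le\ -\partial_x\big(D_U\Psi(\mathcal{E}(u))\,U_1\big).$$
   Context: Setting. Let $1\le n<N$, let $\Omega\subset\mathbb{R}^N$ be an open convex set, and let $F,R:\Omega\to\mathbb{R}^N$ be smooth. Consider, for $\varepsilon>0$, the system $\varepsilon\,\partial_t U+\partial_x F(U)=-R(U)/\varepsilon$, $t>0$, $x\in\mathbb{R}$, $U\in\Omega$. Write $A:=D_UF$ and $B:=D_UR$ (the $N\times N$ Jacobian matrices); $A(U)$ has real eigenvalues and a full basis of eigenvectors. Structural assumptions: (1) There is a constant $n\times N$ matrix $Q$ of rank $n$ with $QR(U)=0$ for all $U\in\Omega$. Set $\omega:=Q\Omega\subset\mathbb{R}^n$. (2) There is a smooth map $\mathcal{E}:\omega\to\Omega$ uniquely determining the local equilibria: $Q\,\mathcal{E}(u)=u$ and $R(\mathcal{E}(u))=0$ for all $u\in\omega$. The equilibrium manifold is $\mathcal{M}:=\{U=\mathcal{E}(u):u\in\omega\}$. (3) For all $u\in\omega$: $\dim\ker B(\mathcal{E}(u))=n$ and $\ker B(\mathcal{E}(u))\cap\operatorname{Im}B(\mathcal{E}(u))=\{0\}$.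 (4) $QF(\mathcal{E}(u))=0$ for all $u\in\omega$. Entropy assumptions: there is a smooth function $\Phi:\Omega\to\mathbb{R}$ with $D^2_U\Phi(U)$ positive definite and $D^2_U\Phi(U)A(U)$ symmetric for all $U\in\Omega$, and a smooth $\Psi:\Omega\to\mathbb{R}$ with $D_U\Phi(U)A(U)=D_U\Psi(U)$ on $\Omega$ (first derivatives are row vectors). Moreover (5) $D_U\Phi(U)R(U)\ge0$ for all $U\in\Omega$; (6) there is a map $\nu:\mathcal{M}\to\mathbb{R}^n$ (row-vector valued) such that $D_U\Phi=\nu\,Q$ on $\mathcal{M}$. The limiting system is the one obtained formally as $\varepsilon\to0$ from the expansion $U^\varepsilon=\mathcal{E}(u)+\varepsilon U_1+\varepsilon^2U_2+\cdots$ with $QU^\varepsilon=u$. *)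

theory Defs
  imports "HOL-Analysis.Analysis"
begin

text \<open>
  Smoothness is meant for open sets \<open>S\<close>: the derivatives are full (not one-sided) Frechet
  derivatives, and \<open>f\<close> is \<open>k\<close> times continuously differentiable iff all iterated directional
  derivatives up to order \<open>k\<close> exist in this sense and are continuous.
\<close>

primrec k_times_differentiable_on ::
    "'a::real_normed_vector set \<Rightarrow> ('a \<Rightarrow> 'b::real_normed_vector) \<Rightarrow> nat \<Rightarrow> bool" where
  "k_times_differentiable_on S f 0 \<longleftrightarrow> continuous_on S f"
| "k_times_differentiable_on S f (Suc k) \<longleftrightarrow>
     (\<forall>x\<in>S. f differentiable (at x)) \<and>
     (\<forall>v. k_times_differentiable_on S (\<lambda>x. frechet_derivative f (at x) v) k)"

definition smooth_on :: "'a::real_normed_vector set \<Rightarrow> ('a \<Rightarrow> 'b::real_normed_vector) \<Rightarrow> bool" where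
  "smooth_on S f \<longleftrightarrow> (\<forall>k. k_times_differentiable_on S f k)"

text \<open>
  The row vector of first partial derivatives of a scalar function. Products of row vectors with
  matrices are written \<open>v*\<close>, and the product of a row vector with a column vector is the inner
  product.
\<close>

definition grad :: "(real^'N \<Rightarrow> real) \<Rightarrow> real^'N \<Rightarrow> real^'N" where
  "grad f U = (\<chi> i. frechet_derivative f (at U) (axis i 1))"

abbreviation Jac :: "(real^'N \<Rightarrow> real^'M) \<Rightarrow> real^'N \<Rightarrow> real^'N^'M" where
  "Jac f U \<equiv> jacobian f (at U)"

abbreviation hessian :: "(real^'N \<Rightarrow> real) \<Rightarrow> real^'N \<Rightarrow> real^'N^'N" where
  "hessian f U \<equiv> Jac (grad f) U"

definition positive_definite :: "real^'N^'N \<Rightarrow> bool" where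
  "positive_definite H \<longleftrightarrow> transpose H = H \<and> (\<forall>v. v \<noteq> 0 \<longrightarrow> v \<bullet> (H *v v) > 0)"

definition real_diagonalizable :: "real^'N^'N \<Rightarrow> bool" where
  "real_diagonalizable A \<longleftrightarrow>
     (\<exists>S. independent S \<and> span S = UNIV \<and> (\<forall>v\<in>S. \<exists>c. A *v v = c *\<^sub>R v))"

text \<open>
  The equations determining the first-order term \<open>U\<^sub>1\<close> of the expansion at the point \<open>x\<close>.
  The argument \<open>w\<close> is the state \<open>u(t,\<cdot>)\<close> at a fixed time, a function of the space variable.
\<close>

definition corrector_equations ::
    "(real^'N \<Rightarrow> real^'N) \<Rightarrow> (real^'N \<Rightarrow> real^'N) \<Rightarrow> real^'N^'n \<Rightarrow> (real^'n \<Rightarrow> real^'N) \<Rightarrow>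
     (real \<Rightarrow> real^'n) \<Rightarrow> real \<Rightarrow> real^'N \<Rightarrow> bool" where
  "corrector_equations F R Q \<E> w x V \<longleftrightarrow>
     Jac R (\<E> (w x)) *v V = - vector_derivative (\<lambda>y. F (\<E> (w y))) (at x) \<and>
     Q *v V = 0"

definition corrector ::
    "(real^'N \<Rightarrow> real^'N) \<Rightarrow> (real^'N \<Rightarrow> real^'N) \<Rightarrow> real^'N^'n \<Rightarrow> (real^'n \<Rightarrow> real^'N) \<Rightarrow>
     (real \<Rightarrow> real^'n) \<Rightarrow> real \<Rightarrow> real^'N" where
  "corrector F R Q \<E> w x = (THE V. corrector_equations F R Q \<E> w x V)"

end

theory Submission
  imports Defs
begin

text \<open>
  Write \<open>H\<close> for the Hessian of the entropy and \<open>A\<close>, \<open>B\<close> for the Jacobians of \<open>F\<close>, \<open>R\<close>, all taken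
  at \<open>\<E>(u)\<close>. On the equilibrium manifold the entropy gradient is \<open>\<nu> Q\<close>, so it sees a state only
  through its conserved part \<open>Q U\<close>. Hence \<open>\<partial>\<^sub>t \<Phi>(\<E>(u)) = \<nu> \<partial>\<^sub>t u = - \<nu> \<partial>\<^sub>x (Q A U\<^sub>1)\<close>, while
  the flux is \<open>D\<Psi> U\<^sub>1 = \<nu> Q A U\<^sub>1\<close>. By the product rule the two nearly cancel:
  \<open>\<partial>\<^sub>t \<Phi>(\<E>(u)) + \<partial>\<^sub>x (D\<Psi> U\<^sub>1) = (\<partial>\<^sub>x \<nu>) Q A U\<^sub>1 = (H \<partial>\<^sub>x \<E>(u)) \<bullet> A U\<^sub>1\<close>
  (lemma \<open>multiplier_product_rule\<close>). Because \<open>H\<close> and \<open>H A\<close> are symmetric, \<open>A\<close> can be moved to the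
  other factor, where it produces \<open>A \<partial>\<^sub>x \<E>(u) = \<partial>\<^sub>x F(\<E>(u)) = - B U\<^sub>1\<close>. What remains is
  \<open>- H U\<^sub>1 \<bullet> B U\<^sub>1\<close>. This is nonpositive since \<open>D\<Phi> R\<close> is nonnegative and vanishes at equilibrium,
  and \<open>H V \<bullet> B V\<close> is its second-order Taylor term there in direction \<open>V\<close>
  (lemma \<open>hessian_dissipation_nonneg\<close>).

  The argument differentiates \<open>U\<^sub>1\<close> in space, so its regularity has to be established. With a right
  inverse \<open>L\<close> of \<open>Q\<close>, the two equations for \<open>U\<^sub>1\<close> are equivalent to the single square system
  \<open>(B + L Q) U\<^sub>1 = - \<partial>\<^sub>x F(\<E>(u))\<close> (lemma \<open>bordered_system_iff\<close>). The structural conditions make its matrix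
  invertible (lemma \<open>det_bordered_nonzero\<close>), which yields existence and uniqueness; Cramer's rule
  then turns the regularity of the coefficients into regularity of the solution
  (lemma \<open>differentiable_linear_solve\<close>).
\<close>

section \<open>Calculus\<close>

lemma smooth_on_imp_differentiable:
  assumes "smooth_on S f" "x \<in> S"
  shows "f differentiable (at x)"
proof -
  have "k_times_differentiable_on S f (Suc 0)"
    using assms(1) unfolding smooth_on_def by blast
  then show ?thesis
    using assms(2) by simp
qed

lemma smooth_on_frechet_derivative:
  assumes "smooth_on S f"
  shows "smooth_on S (\<lambda>x. frechet_derivative f (at x) v)"
  unfolding smooth_on_def
proof
  fix k
  have "k_times_differentiable_on S f (Suc k)"
    using assms unfolding smooth_on_def by blast
  then show "k_times_differentiable_on S (\<lambda>x. frechet_derivative f (at x) v) k"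
    by simp
qed

lemma has_derivative_eventually_eq:
  assumes "(f has_derivative D) (at x)" "eventually (\<lambda>y. f y = g y) (nhds x)"
  shows "(g has_derivative D) (at x)"
  using has_derivative_transform_eventually[OF assms(1), of g] assms(2)
    eventually_nhds_x_imp_x[OF assms(2)]
  by (simp add: eventually_at_filter eventually_mono)

lemma partial_has_vector_derivative:
  fixes U :: "real \<times> real \<Rightarrow> 'a::real_normed_vector"
  assumes "(U has_derivative U') (at (t, x))"
  shows "((\<lambda>s. U (s, x)) has_vector_derivative U' (1, 0)) (at t)"
    and "((\<lambda>y. U (t, y)) has_vector_derivative U' (0, 1)) (at x)"
proof -
  have scale: "U' (r *\<^sub>R v) = r *\<^sub>R U' v" for r v
    using assms has_derivative_linear linear_scale by blast
  have "((\<lambda>s. (s, x)) has_derivative (\<lambda>h. h *\<^sub>R (1, 0))) (at t)"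
    "((\<lambda>y. (t, y)) has_derivative (\<lambda>h. h *\<^sub>R (0, 1))) (at x)"
    by (auto intro!: derivative_eq_intros)
  from this[THEN has_derivative_compose, OF assms]
  show "((\<lambda>s. U (s, x)) has_vector_derivative U' (1, 0)) (at t)"
    and "((\<lambda>y. U (t, y)) has_vector_derivative U' (0, 1)) (at x)"
    unfolding has_vector_derivative_def scale .
qed

lemma has_derivative_grad:
  fixes f :: "real^'N \<Rightarrow> real"
  assumes "f differentiable (at U)"
  shows "(f has_derivative (\<lambda>h. grad f U \<bullet> h)) (at U)"
proof -
  let ?D = "frechet_derivative f (at U)"
  have D: "(f has_derivative ?D) (at U)"
    using assms frechet_derivative_works by blast
  then have lin: "linear ?D"
    by (rule has_derivative_linear)
  have "?D h = grad f U \<bullet> h" for h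
  proof -
    have "?D h = ?D (\<Sum>i\<in>UNIV. h $ i *\<^sub>R axis i 1)"
      using basis_expansion[of h] by (simp add: scalar_mult_eq_scaleR)
    also have "\<dots> = grad f U \<bullet> h"
      by (simp add: linear_sum[OF lin] linear_scale[OF lin] grad_def inner_vec_def mult.commute)
    finally show ?thesis .
  qed
  with D show ?thesis
    by (metis has_derivative_eq_rhs ext)
qed

lemma differentiable_vec_nth:
  fixes f :: "'a::real_normed_vector \<Rightarrow> 'b::real_normed_vector^'n"
  shows "f differentiable F \<Longrightarrow> (\<lambda>x. f x $ i) differentiable F"
  unfolding differentiable_def
  by (blast intro: bounded_linear.has_derivative[OF bounded_linear_vec_nth])

lemma differentiable_vec_componentwise:
  fixes f :: "'a::real_normed_vector \<Rightarrow> 'b::euclidean_space^'n"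
  assumes "\<And>i. (\<lambda>x. f x $ i) differentiable (at x within S)"
  shows "f differentiable (at x within S)"
proof -
  have "(\<lambda>y. f y \<bullet> b) differentiable (at x within S)" if "b \<in> Basis" for b
  proof -
    obtain i v where "b = axis i v"
      using \<open>b \<in> Basis\<close> unfolding Basis_vec_def by blast
    moreover obtain D where "((\<lambda>y. f y $ i) has_derivative D) (at x within S)"
      using assms[of i] unfolding differentiable_def by blast
    then have "(\<lambda>y. f y $ i \<bullet> v) differentiable (at x within S)"
      unfolding differentiable_def
      using bounded_linear.has_derivative[OF bounded_linear_inner_left] by metis
    ultimately show ?thesis
      by (simp add: inner_axis)
  qed
  then show ?thesis
    by (subst differentiable_componentwise_within) blast
qed

lemma smooth_on_grad_differentiable:
  fixes f :: "real^'N \<Rightarrow> real"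
  assumes "smooth_on S f" "U \<in> S"
  shows "grad f differentiable (at U)"
proof (rule differentiable_vec_componentwise)
  fix i
  show "(\<lambda>x. grad f x $ i) differentiable (at U)"
    using smooth_on_imp_differentiable[OF smooth_on_frechet_derivative[OF assms(1)] assms(2)]
    by (simp add: grad_def)
qed

lemma smooth_on_Jac_differentiable:
  fixes f :: "real^'N \<Rightarrow> real^'M"
  assumes "smooth_on S f" "U \<in> S"
  shows "(\<lambda>U. Jac f U) differentiable (at U)"
proof (intro differentiable_vec_componentwise)
  fix i j
  have "(\<lambda>x. frechet_derivative f (at x) (axis j 1) $ i) differentiable (at U)"
    by (rule differentiable_vec_nth[OF smooth_on_imp_differentiable
          [OF smooth_on_frechet_derivative[OF assms(1)] assms(2)]])
  then show "(\<lambda>x. Jac f x $ i $ j) differentiable (at U)"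
    by (simp add: jacobian_def matrix_def)
qed

lemma differentiable_matrix_vector_mult:
  fixes A :: "'a::real_normed_vector \<Rightarrow> real^'n^'m"
  assumes "A differentiable (at x within S)" "V differentiable (at x within S)"
  shows "(\<lambda>y. A y *v V y) differentiable (at x within S)"
proof (rule differentiable_vec_componentwise)
  fix i
  show "(\<lambda>y. (A y *v V y) $ i) differentiable (at x within S)"
    unfolding matrix_vector_mul_component
    by (intro differentiable_inner differentiable_vec_nth assms)
qed

lemma differentiable_prod_finite:
  fixes f :: "'i \<Rightarrow> 'a::real_normed_vector \<Rightarrow> 'b::real_normed_field"
  assumes "\<And>i. i \<in> I \<Longrightarrow> f i differentiable (at x within S)"
  shows "(\<lambda>y. \<Prod>i\<in>I. f i y) differentiable (at x within S)"
  using assms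
  by (induction I rule: infinite_finite_induct) (auto intro!: differentiable_mult)

lemma differentiable_det:
  fixes A :: "'a::real_normed_vector \<Rightarrow> real^'n^'n"
  assumes "\<And>i j. (\<lambda>y. A y $ i $ j) differentiable (at x within S)"
  shows "(\<lambda>y. det (A y)) differentiable (at x within S)"
  unfolding det_def
  by (intro differentiable_sum ballI finite differentiable_mult differentiable_const
      differentiable_prod_finite assms)

text \<open>
  By Cramer's rule the solution is a quotient of determinants, which are polynomials in the entries of
  the matrix and of the right-hand side.
\<close>

lemma differentiable_linear_solve:
  fixes A :: "'a::real_normed_vector \<Rightarrow> real^'n^'n"
  assumes A: "A differentiable (at x)" and b: "b differentiable (at x)"
    and solves: "eventually (\<lambda>y. det (A y) \<noteq> 0 \<and> A y *v V y = b y) (nhds x)"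
  shows "V differentiable (at x)"
proof -
  define W where
    "W = (\<lambda>y. \<chi> k. det (\<chi> i j. if j = k then b y $ i else A y $ i $ j) / det (A y))"
  have det_x: "det (A x) \<noteq> 0"
    using eventually_nhds_x_imp_x[OF solves] by blast
  have "W differentiable (at x)"
  proof (rule differentiable_vec_componentwise)
    fix k
    have entry: "(\<lambda>y. A y $ i $ j) differentiable (at x)" for i j
      by (intro differentiable_vec_nth A)
    have rhs: "(\<lambda>y. b y $ i) differentiable (at x)" for i
      by (intro differentiable_vec_nth b)
    have "(\<lambda>y. det (\<chi> i j. if j = k then b y $ i else A y $ i $ j) / det (A y))
            differentiable (at x)"
    proof (intro differentiable_divide differentiable_det entry det_x)
      fix i j
      show "(\<lambda>y. (\<chi> i j. if j = k then b y $ i else A y $ i $ j) $ i $ j) differentiable (at x)"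
        using entry rhs by (cases "j = k") simp_all
    qed
    then show "(\<lambda>y. W y $ k) differentiable (at x)"
      by (simp add: W_def)
  qed
  then obtain W' where W': "(W has_derivative W') (at x)"
    unfolding differentiable_def by blast
  have eq: "eventually (\<lambda>y. W y = V y) (nhds x)"
    using solves
  proof eventually_elim
    case (elim y)
    then show ?case
      unfolding W_def using iffD1[OF cramer, of "A y" "V y" "b y"] by simp
  qed
  show ?thesis
    using has_derivative_eventually_eq[OF W' eq] unfolding differentiable_def by blast
qed

section \<open>Linear algebra of the relaxation operator\<close>

lemma dim_kernel_plus_rank:
  fixes A :: "real^'n^'m"
  shows "dim {x. A *v x = 0} + rank A = CARD('n)"
proof -
  have "{x. A *v x = 0} = {y \<in> UNIV. \<forall>x \<in> span (rows A). orthogonal x y}"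
  proof (intro set_eqI iffI)
    fix y assume "y \<in> {y \<in> UNIV. \<forall>x \<in> span (rows A). orthogonal x y}"
    then have "row i A \<bullet> y = 0" for i
      by (auto simp: orthogonal_def rows_def intro: span_base)
    then show "y \<in> {x. A *v x = 0}"
      by (simp add: vec_eq_iff matrix_vector_mul_component row_def)
  qed (use orthogonal_nullspace_rowspace orthogonal_commute in blast)
  then show ?thesis
    using dim_subspace_orthogonal_to_vectors[of "span (rows A)" UNIV]
    by (simp add: row_rank_def)
qed

text \<open>
  The inclusion of the range in the kernel is \<open>Q B = 0\<close>; both spaces have dimension \<open>N - n\<close>.
\<close>

lemma range_eq_kernel:
  fixes B :: "real^'N^'N" and Q :: "real^'N^'n"
  assumes rank_Q: "rank Q = CARD('n)"
    and QB: "Q ** B = 0"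
    and dim_ker: "dim {V. B *v V = 0} = CARD('n)"
  shows "range ((*v) B) = {V. Q *v V = 0}"
proof (rule subspace_dim_equal)
  show "subspace (range ((*v) B))"
    by (intro linear_subspace_image matrix_vector_mul_linear subspace_UNIV)
  show "subspace {V. Q *v V = 0}"
    by (intro linear_subspace_kernel matrix_vector_mul_linear)
  show "range ((*v) B) \<subseteq> {V. Q *v V = 0}"
    using QB by (auto simp: matrix_vector_mul_assoc)
  have "dim {V. Q *v V = 0} + CARD('n) = CARD('N)"
    using dim_kernel_plus_rank[of Q] rank_Q by simp
  moreover have "CARD('n) + dim (range ((*v) B)) = CARD('N)"
    using dim_kernel_plus_rank[of B] dim_ker by (simp add: rank_dim_range)
  ultimately show "dim {V. Q *v V = 0} \<le> dim (range ((*v) B))"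
    by linarith
qed

text \<open>
  Multiplying the square system by \<open>Q\<close> leaves only \<open>Q V = 0\<close>, because \<open>Q B\<close> and \<open>Q b\<close> vanish and
  \<open>Q L\<close> is the identity; the added term \<open>L Q V\<close> then drops out.
\<close>

lemma bordered_system_iff:
  fixes B :: "real^'N^'N" and Q :: "real^'N^'n" and L :: "real^'n^'N"
  assumes QL: "Q ** L = mat 1" and QB: "Q ** B = 0" and Qb: "Q *v b = 0"
  shows "(B + L ** Q) *v V = b \<longleftrightarrow> B *v V = b \<and> Q *v V = 0"
proof
  assume V: "(B + L ** Q) *v V = b"
  have "Q *v ((B + L ** Q) *v V) = (Q ** B) *v V + (Q ** L) *v (Q *v V)"
    by (simp add: matrix_vector_mult_add_rdistrib matrix_vector_right_distrib
        matrix_vector_mul_assoc matrix_mul_assoc)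
  with V have QV: "Q *v V = 0"
    by (simp add: QB QL Qb)
  with V show "B *v V = b \<and> Q *v V = 0"
    by (simp add: matrix_vector_mult_add_rdistrib flip: matrix_vector_mul_assoc)
qed (simp add: matrix_vector_mult_add_rdistrib flip: matrix_vector_mul_assoc)

text \<open>
  A null vector lies in the kernels of both \<open>B\<close> and \<open>Q\<close>. The latter is the range of \<open>B\<close>, which meets
  the kernel of \<open>B\<close> only in zero.
\<close>

lemma det_bordered_nonzero:
  fixes B :: "real^'N^'N" and Q :: "real^'N^'n" and L :: "real^'n^'N"
  assumes rank_Q: "rank Q = CARD('n)"
    and QL: "Q ** L = mat 1"
    and QB: "Q ** B = 0"
    and dim_ker: "dim {V. B *v V = 0} = CARD('n)"
    and ker_Im: "{V. B *v V = 0} \<inter> range ((*v) B) = {0}"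
  shows "det (B + L ** Q) \<noteq> 0"
proof -
  have "V = 0" if "(B + L ** Q) *v V = 0" for V
  proof -
    have "B *v V = 0" "Q *v V = 0"
      using that bordered_system_iff[OF QL QB, of 0 V] by simp_all
    then show "V = 0"
      using ker_Im range_eq_kernel[OF rank_Q QB dim_ker] by blast
  qed
  then have "invertible (B + L ** Q)"
    by (simp add: invertible_left_inverse matrix_left_invertible_ker)
  then show ?thesis
    by (simp add: invertible_det_nz)
qed

section \<open>Entropy dissipation\<close>

lemma Jac_annihilated:
  fixes R :: "real^'N \<Rightarrow> real^'N" and Q :: "real^'N^'n"
  assumes "open \<Omega>" "U \<in> \<Omega>" and QR: "\<And>W. W \<in> \<Omega> \<Longrightarrow> Q *v R W = 0"
    and R: "R differentiable (at U)"
  shows "Q ** Jac R U = 0"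
proof -
  have "(R has_derivative (*v) (Jac R U)) (at U)"
    using R jacobian_works by blast
  then have "((\<lambda>W. Q *v R W) has_derivative (\<lambda>h. Q *v (Jac R U *v h))) (at U)"
    by (rule bounded_linear.has_derivative[OF matrix_vector_mul_bounded_linear])
  moreover have "((\<lambda>W. Q *v R W) has_derivative (\<lambda>h. 0)) (at U)"
    by (rule has_derivative_transform_within_open[OF has_derivative_const assms(1,2)])
      (simp add: QR)
  ultimately have "(\<lambda>h. Q *v (Jac R U *v h)) = (\<lambda>h. 0)"
    by (rule has_derivative_unique)
  then have "(Q ** Jac R U) *v h = 0" for h
    by (metis matrix_vector_mul_assoc)
  then show ?thesis
    by (simp add: matrix_eq)
qed

text \<open>
  Let \<open>G\<close> be the entropy gradient. Since \<open>G(U)\<close> is a combination of rows of \<open>Q\<close>, it is orthogonal to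
  all values of \<open>R\<close>; and \<open>R(U) = 0\<close>. So along the line \<open>W = U + s V\<close> the dissipation equals
  \<open>(G(W) - G(U)) \<bullet> (R(W) - R(U))\<close>. Dividing by \<open>s\<^sup>2\<close> and letting \<open>s\<close> tend to zero gives the claim
  from first derivatives of \<open>G\<close> and \<open>R\<close> alone.
\<close>

lemma hessian_dissipation_nonneg:
  fixes R G :: "real^'N \<Rightarrow> real^'N" and Q :: "real^'N^'n"
  assumes "open \<Omega>" "U \<in> \<Omega>"
    and dissipation: "\<And>W. W \<in> \<Omega> \<Longrightarrow> G W \<bullet> R W \<ge> 0"
    and QR: "\<And>W. W \<in> \<Omega> \<Longrightarrow> Q *v R W = 0"
    and eq: "R U = 0" "G U = \<nu> v* Q"
    and G: "G differentiable (at U)" and R: "R differentiable (at U)"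
  shows "(Jac G U *v V) \<bullet> (Jac R U *v V) \<ge> 0"
proof -
  have line: "((\<lambda>s. U + s *\<^sub>R V) has_derivative (\<lambda>s. s *\<^sub>R V)) (at 0)"
    by (auto intro!: derivative_eq_intros)
  have quotient: "((\<lambda>s. (f (U + s *\<^sub>R V) - f U) /\<^sub>R s) \<longlongrightarrow> Jac f U *v V) (at 0)"
    if "f differentiable (at U)" for f :: "real^'N \<Rightarrow> real^'N"
  proof -
    have "(f has_derivative (*v) (Jac f U)) (at (U + 0 *\<^sub>R V))"
      using that by (simp add: jacobian_works[symmetric])
    from has_derivative_compose[OF line this]
    have "((\<lambda>s. f (U + s *\<^sub>R V)) has_vector_derivative Jac f U *v V) (at 0)"
      by (simp add: has_vector_derivative_def matrix_vector_mult_scaleR)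
    then have "((\<lambda>s. norm (f (U + s *\<^sub>R V) - f U - s *\<^sub>R (Jac f U *v V)) / norm s) \<longlongrightarrow> 0) (at 0)"
      by (simp add: has_vector_derivative_def has_derivative_iff_norm)
    then have "((\<lambda>s. norm ((f (U + s *\<^sub>R V) - f U) /\<^sub>R s - Jac f U *v V)) \<longlongrightarrow> 0) (at 0)"
    proof (rule Lim_transform_eventually)
      show "\<forall>\<^sub>F s in at 0. norm (f (U + s *\<^sub>R V) - f U - s *\<^sub>R (Jac f U *v V)) / norm s =
          norm ((f (U + s *\<^sub>R V) - f U) /\<^sub>R s - Jac f U *v V)"
        unfolding eventually_at_filter
      proof (intro always_eventually allI impI)
        fix s :: real assume "s \<noteq> 0"
        then have "(f (U + s *\<^sub>R V) - f U) /\<^sub>R s - Jac f U *v V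
            = inverse s *\<^sub>R (f (U + s *\<^sub>R V) - f U - s *\<^sub>R (Jac f U *v V))"
          by (simp add: scaleR_diff_right)
        then show "norm (f (U + s *\<^sub>R V) - f U - s *\<^sub>R (Jac f U *v V)) / norm s =
            norm ((f (U + s *\<^sub>R V) - f U) /\<^sub>R s - Jac f U *v V)"
          by (simp add: divide_inverse mult.commute)
      qed
    qed
    then show ?thesis
      by (rule Lim_null[THEN iffD2, OF tendsto_norm_zero_cancel])
  qed
  have lim: "((\<lambda>s. ((G (U + s *\<^sub>R V) - G U) /\<^sub>R s) \<bullet> ((R (U + s *\<^sub>R V) - R U) /\<^sub>R s))
          \<longlongrightarrow> (Jac G U *v V) \<bullet> (Jac R U *v V)) (at 0)"
    by (intro tendsto_inner quotient G R)
  have "((\<lambda>s. U + s *\<^sub>R V) \<longlongrightarrow> U + 0 *\<^sub>R V) (at 0)"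
    by (intro tendsto_intros)
  then have "eventually (\<lambda>s. U + s *\<^sub>R V \<in> \<Omega>) (at 0)"
    using assms(1,2) by (simp add: topological_tendstoD)
  then have "eventually (\<lambda>s. 0 \<le> ((G (U + s *\<^sub>R V) - G U) /\<^sub>R s) \<bullet> ((R (U + s *\<^sub>R V) - R U) /\<^sub>R s))
      (at 0)"
  proof eventually_elim
    fix s assume s: "U + s *\<^sub>R V \<in> \<Omega>"
    have "G U \<bullet> R (U + s *\<^sub>R V) = 0"
      by (simp add: eq dot_lmul_matrix QR s)
    then have "((G (U + s *\<^sub>R V) - G U) /\<^sub>R s) \<bullet> ((R (U + s *\<^sub>R V) - R U) /\<^sub>R s)
        = (G (U + s *\<^sub>R V) \<bullet> R (U + s *\<^sub>R V)) * (inverse s)\<^sup>2"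
      by (simp add: eq inner_diff_left power2_eq_square)
    then show "0 \<le> ((G (U + s *\<^sub>R V) - G U) /\<^sub>R s) \<bullet> ((R (U + s *\<^sub>R V) - R U) /\<^sub>R s)"
      using dissipation[OF s] by simp
  qed
  then show ?thesis
    by (rule tendsto_lowerbound[OF lim]) simp
qed


section \<open>The entropy balance\<close>

lemma has_vector_derivative_Jac_compose:
  fixes f :: "real^'N \<Rightarrow> real^'M"
  assumes "(c has_vector_derivative c') (at y)" "f differentiable (at (c y))"
  shows "((\<lambda>y. f (c y)) has_vector_derivative Jac f (c y) *v c') (at y)"
proof -
  have "(f has_derivative (*v) (Jac f (c y))) (at (c y))"
    using assms(2) by (simp add: jacobian_works[symmetric])
  from has_derivative_compose[OF assms(1)[unfolded has_vector_derivative_def] this]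
  show ?thesis
    by (simp add: has_vector_derivative_def matrix_vector_mult_scaleR)
qed

lemma has_field_derivative_grad_compose:
  fixes f :: "real^'N \<Rightarrow> real"
  assumes "(c has_vector_derivative c') (at y)" "f differentiable (at (c y))"
  shows "((\<lambda>y. f (c y)) has_field_derivative grad f (c y) \<bullet> c') (at y)"
proof -
  from has_derivative_compose[OF assms(1)[unfolded has_vector_derivative_def]
      has_derivative_grad[OF assms(2)]]
  show ?thesis
    by (simp add: has_field_derivative_def mult_commute_abs)
qed

lemma has_vector_derivative_eventually_unique:
  assumes "(f has_vector_derivative f') (at x)" "(g has_vector_derivative g') (at x)"
    and "eventually (\<lambda>y. f y = g y) (nhds x)"
  shows "f' = g'"
proof -
  have "(g has_vector_derivative f') (at x)"
    using has_derivative_eventually_eq assms(1,3) unfolding has_vector_derivative_def by blast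
  then show ?thesis
    using assms(2) vector_derivative_unique_at by blast
qed

text \<open>
  Formally this is the product rule for \<open>\<nu> \<bullet> Q W\<close>, followed by \<open>(\<partial>\<^sub>x \<nu>) Q = \<partial>\<^sub>x G\<close>. The multiplier \<open>\<nu>\<close>
  is not assumed regular; but along the curve it equals \<open>G L\<close> and thus inherits differentiability
  from \<open>G\<close>.
\<close>

lemma multiplier_product_rule:
  fixes G :: "real^'N \<Rightarrow> real^'N" and Q :: "real^'N^'n" and L :: "real^'n^'N"
  assumes QL: "Q ** L = mat 1"
    and c: "(c has_vector_derivative c') (at x)"
    and G: "G differentiable (at (c x))"
    and multiplier: "eventually (\<lambda>y. G (c y) = \<nu> (c y) v* Q) (nhds x)"
    and q: "((\<lambda>y. Q *v W y) has_vector_derivative q') (at x)"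
  shows "((\<lambda>y. G (c y) \<bullet> W y) has_field_derivative
            \<nu> (c x) \<bullet> q' + (Jac G (c x) *v c') \<bullet> W x) (at x)"
proof -
  let ?g' = "Jac G (c x) *v c'"
  have "((\<lambda>y. G (c y)) has_vector_derivative ?g') (at x)"
    by (rule has_vector_derivative_Jac_compose[OF c G])
  note g = this
  define n where "n = (\<lambda>y. G (c y) v* L)"
  have n: "(n has_vector_derivative ?g' v* L) (at x)"
    using bounded_linear.has_vector_derivative[OF
        matrix_vector_mul_bounded_linear[of "transpose L"] g]
    by (simp add: n_def)
  have n_eq: "eventually (\<lambda>y. n y = \<nu> (c y)) (nhds x)"
    using multiplier
    by eventually_elim (simp add: n_def vector_matrix_mul_assoc QL)
  have nQ: "((\<lambda>y. n y v* Q) has_vector_derivative (?g' v* L) v* Q) (at x)"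
    using bounded_linear.has_vector_derivative[OF
        matrix_vector_mul_bounded_linear[of "transpose Q"] n]
    by simp
  have g'_eq: "?g' = (?g' v* L) v* Q"
  proof (rule has_vector_derivative_eventually_unique[OF g nQ])
    show "eventually (\<lambda>y. G (c y) = n y v* Q) (nhds x)"
      using multiplier n_eq by eventually_elim simp
  qed
  have "((\<lambda>y. n y \<bullet> (Q *v W y)) has_derivative
      (\<lambda>h. n x \<bullet> (h *\<^sub>R q') + (h *\<^sub>R (?g' v* L)) \<bullet> (Q *v W x))) (at x)"
    by (rule has_derivative_inner[OF n[unfolded has_vector_derivative_def]
          q[unfolded has_vector_derivative_def]])
  moreover have "eventually (\<lambda>y. n y \<bullet> (Q *v W y) = G (c y) \<bullet> W y) (nhds x)"
    using multiplier n_eq by eventually_elim (simp add: dot_lmul_matrix)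
  ultimately have "((\<lambda>y. G (c y) \<bullet> W y) has_derivative
      (\<lambda>h. n x \<bullet> (h *\<^sub>R q') + (h *\<^sub>R (?g' v* L)) \<bullet> (Q *v W x))) (at x)"
    by (rule has_derivative_eventually_eq)
  moreover have "(?g' v* L) \<bullet> (Q *v W x) = ?g' \<bullet> W x"
    by (subst (2) g'_eq) (simp add: dot_lmul_matrix)
  ultimately show ?thesis
    using eventually_nhds_x_imp_x[OF n_eq]
    unfolding has_field_derivative_def
    by (auto simp: algebra_simps elim!: has_derivative_eq_rhs)
qed

lemma inner_symmetric_matrix:
  fixes H :: "real^'N^'N"
  assumes "transpose H = H"
  shows "(H *v v) \<bullet> w = v \<bullet> (H *v w)"
  using dot_lmul_matrix[of v H w] transpose_matrix_vector[of H v] assms by simp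

text \<open>
  Both sides equal \<open>v \<bullet> H A w\<close>: this is the step in which the entropy symmetrizes the system.
\<close>

lemma symmetrizer_swap:
  fixes H A :: "real^'N^'N"
  assumes "transpose H = H" "transpose (H ** A) = H ** A"
  shows "(H *v v) \<bullet> (A *v w) = (H *v (A *v v)) \<bullet> w"
  using inner_symmetric_matrix[OF assms(1)] inner_symmetric_matrix[OF assms(2)]
  by (simp add: matrix_vector_mul_assoc)

text \<open>
  The compatibility condition \<open>Q f' = 0\<close> on the source term is what allows the corrector equations to
  be read as the square system.
\<close>

lemma corrector_bordered_system:
  fixes F R :: "real^'N \<Rightarrow> real^'N" and Q :: "real^'N^'n" and L :: "real^'n^'N"
    and \<E> :: "real^'n \<Rightarrow> real^'N" and w :: "real \<Rightarrow> real^'n"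
  defines "B \<equiv> \<lambda>y. Jac R (\<E> (w y))"
    and "f' \<equiv> \<lambda>y. vector_derivative (\<lambda>y. F (\<E> (w y))) (at y)"
  assumes rank_Q: "rank Q = CARD('n)"
    and QL: "Q ** L = mat 1"
    and QB: "Q ** B x = 0"
    and dim_ker: "dim {V. B x *v V = 0} = CARD('n)"
    and ker_Im: "{V. B x *v V = 0} \<inter> range ((*v) (B x)) = {0}"
    and Qf': "Q *v f' x = 0"
  shows "det (B x + L ** Q) \<noteq> 0"
    and "\<exists>!V. corrector_equations F R Q \<E> w x V"
    and "(B x + L ** Q) *v corrector F R Q \<E> w x = - f' x"
    and "B x *v corrector F R Q \<E> w x = - f' x"
proof -
  show det: "det (B x + L ** Q) \<noteq> 0"
    by (rule det_bordered_nonzero[OF rank_Q QL QB dim_ker ker_Im])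
  have iff: "corrector_equations F R Q \<E> w x V \<longleftrightarrow> (B x + L ** Q) *v V = - f' x" for V
    unfolding corrector_equations_def
    using bordered_system_iff[OF QL QB, of "- f' x" V] Qf'
    by (simp add: B_def f'_def vec.neg)
  show ex1: "\<exists>!V. corrector_equations F R Q \<E> w x V"
    unfolding iff cramer[OF det] by blast
  then have "corrector_equations F R Q \<E> w x (corrector F R Q \<E> w x)"
    unfolding corrector_def by (rule theI')
  then show "(B x + L ** Q) *v corrector F R Q \<E> w x = - f' x"
    and "B x *v corrector F R Q \<E> w x = - f' x"
    using iff unfolding corrector_equations_def B_def f'_def by blast+
qed

theorem proposition2p3:
  fixes \<Omega> :: "(real^'N) set"
    and F R :: "real^'N \<Rightarrow> real^'N"
    and Q :: "real^'N^'n"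
    and \<omega> :: "(real^'n) set"
    and \<E> :: "real^'n \<Rightarrow> real^'N"
    and \<Phi> \<Psi> :: "real^'N \<Rightarrow> real"
    and \<nu> :: "real^'N \<Rightarrow> real^'n"
    and D :: "(real \<times> real) set"
    and u :: "real \<Rightarrow> real \<Rightarrow> real^'n"
  assumes dims: "CARD('n) < CARD('N)"
    and Omega: "open \<Omega>" "convex \<Omega>"
    and smooth_FR: "smooth_on \<Omega> F" "smooth_on \<Omega> R"
    and hyperbolic: "\<forall>U\<in>\<Omega>. real_diagonalizable (Jac F U)"
    and rank_Q: "rank Q = CARD('n)"
    and QR: "\<forall>U\<in>\<Omega>. Q *v R U = 0"
    and omega: "\<omega> = (\<lambda>U. Q *v U) ` \<Omega>"
    and smooth_E: "smooth_on \<omega> \<E>"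
    and equilibria: "\<forall>v\<in>\<omega>. \<E> v \<in> \<Omega> \<and> Q *v \<E> v = v \<and> R (\<E> v) = 0"
    and equilibria_unique: "\<forall>v\<in>\<omega>. \<forall>U\<in>\<Omega>. Q *v U = v \<and> R U = 0 \<longrightarrow> U = \<E> v"
    and dim_ker: "\<forall>v\<in>\<omega>. dim {V. Jac R (\<E> v) *v V = 0} = CARD('n)"
    and ker_Im: "\<forall>v\<in>\<omega>. {V. Jac R (\<E> v) *v V = 0} \<inter> range (\<lambda>V. Jac R (\<E> v) *v V) = {0}"
    and QF: "\<forall>v\<in>\<omega>. Q *v F (\<E> v) = 0"
    and smooth_entropy: "smooth_on \<Omega> \<Phi>" "smooth_on \<Omega> \<Psi>"
    and entropy_convex: "\<forall>U\<in>\<Omega>. positive_definite (hessian \<Phi> U)"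
    and entropy_sym: "\<forall>U\<in>\<Omega>. transpose (hessian \<Phi> U ** Jac F U) = hessian \<Phi> U ** Jac F U"
    and entropy_flux: "\<forall>U\<in>\<Omega>. grad \<Phi> U v* Jac F U = grad \<Psi> U"
    and dissipation: "\<forall>U\<in>\<Omega>. grad \<Phi> U \<bullet> R U \<ge> 0"
    and nu: "\<forall>U\<in>\<E> ` \<omega>. grad \<Phi> U = \<nu> U v* Q"
    and domain: "open D" "D \<subseteq> {0<..} \<times> UNIV"
    and smooth_u: "smooth_on D (\<lambda>(t, x). u t x)"
    and u_omega: "\<forall>(t, x)\<in>D. u t x \<in> \<omega>"
    and limiting_system: "\<forall>(t, x)\<in>D.
      vector_derivative (\<lambda>s. u s x) (at t) =
        - vector_derivative (\<lambda>y. Q *v (Jac F (\<E> (u t y)) *v corrector F R Q \<E> (u t) y)) (at x)"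
  shows "\<forall>(t, x)\<in>D.
      (\<exists>!V. corrector_equations F R Q \<E> (u t) x V) \<and>
      (\<lambda>s. \<Phi> (\<E> (u s x))) differentiable (at t) \<and>
      (\<lambda>y. grad \<Psi> (\<E> (u t y)) \<bullet> corrector F R Q \<E> (u t) y) differentiable (at x) \<and>
      deriv (\<lambda>s. \<Phi> (\<E> (u s x))) t
        \<le> - deriv (\<lambda>y. grad \<Psi> (\<E> (u t y)) \<bullet> corrector F R Q \<E> (u t) y) x"
proof -
  obtain L :: "real^'n^'N" where QL: "Q ** L = mat 1"
    using rank_Q full_rank_surjective matrix_right_invertible_surjective by blast
  have D_F: "F differentiable (at U)" "R differentiable (at U)" "\<Phi> differentiable (at U)"
      "grad \<Phi> differentiable (at U)"
      "Jac F differentiable (at U)" "Jac R differentiable (at U)" if "U \<in> \<Omega>" for U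
    using that smooth_FR smooth_entropy
    by (auto intro: smooth_on_imp_differentiable smooth_on_grad_differentiable
        smooth_on_Jac_differentiable)
  have D_E: "\<E> differentiable (at v)" "Jac \<E> differentiable (at v)" if "v \<in> \<omega>" for v
    using that smooth_E
    by (auto intro: smooth_on_imp_differentiable smooth_on_Jac_differentiable)
  have QB: "Q ** Jac R U = 0" if "U \<in> \<Omega>" for U
    using Jac_annihilated[OF Omega(1) that] QR D_F(2)[OF that] by blast
  define U where "U = (\<lambda>(t, x). u t x)"
  define ut where "ut = (\<lambda>t x. frechet_derivative U (at (t, x)) (1, 0))"
  define ux where "ux = (\<lambda>t x. frechet_derivative U (at (t, x)) (0, 1))"
  have DU: "(U has_derivative frechet_derivative U (at p)) (at p)" if "p \<in> D" for p
    using smooth_on_imp_differentiable[OF smooth_u that]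
    by (simp add: U_def frechet_derivative_works)
  have u_t: "((\<lambda>s. u s x) has_vector_derivative ut t x) (at t)" if "(t, x) \<in> D" for t x
    using partial_has_vector_derivative(1)[OF DU[OF that]] by (simp add: U_def ut_def)
  have u_x: "(u t has_vector_derivative ux t x) (at x)" if "(t, x) \<in> D" for t x
    using partial_has_vector_derivative(2)[OF DU[OF that]] by (simp add: U_def ux_def)
  have ux_diff: "ux t differentiable (at x)" if "(t, x) \<in> D" for t x
  proof -
    have "(\<lambda>p. frechet_derivative U (at p) (0, 1)) differentiable (at (t, x))"
      using smooth_on_imp_differentiable[OF smooth_on_frechet_derivative[OF smooth_u] that]
      by (simp add: U_def)
    moreover have "(\<lambda>y. (t, y)) differentiable (at x)"
      unfolding differentiable_def by (auto intro!: derivative_eq_intros)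
    ultimately show ?thesis
      unfolding ux_def by (rule differentiable_compose)
  qed
  show ?thesis
  proof (clarify, intro conjI)
    fix t x assume tx: "(t, x) \<in> D"
    let ?V = "corrector F R Q \<E> (u t)"
    define c where "c = (\<lambda>y. \<E> (u t y))"
    define c' where "c' = (\<lambda>y. Jac \<E> (u t y) *v ux t y)"
    have near_x: "\<forall>\<^sub>F z in nhds y. (t, z) \<in> D" if ty: "(t, y) \<in> D" for y
    proof -
      have "((\<lambda>z. (t, z)) \<longlongrightarrow> (t, y)) (nhds y)"
        by (auto intro!: tendsto_intros simp: filterlim_ident)
      then show ?thesis
        using domain(1) ty topological_tendstoD by blast
    qed
    have "((\<lambda>s. (s, x)) \<longlongrightarrow> (t, x)) (nhds t)"
      by (auto intro!: tendsto_intros simp: filterlim_ident)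
    then have near_t: "\<forall>\<^sub>F s in nhds t. (s, x) \<in> D"
      using domain(1) tx topological_tendstoD by blast
    have om: "u s y \<in> \<omega>" if "(s, y) \<in> D" for s y
      using u_omega that by blast
    have Om: "\<E> (u s y) \<in> \<Omega>" if "(s, y) \<in> D" for s y
      using equilibria om[OF that] by blast
    have c: "(c has_vector_derivative c' y) (at y)" if "(t, y) \<in> D" for y
      unfolding c_def c'_def
      by (rule has_vector_derivative_Jac_compose[OF u_x[OF that] D_E(1)[OF om[OF that]]])
    have Fc: "((\<lambda>y. F (c y)) has_vector_derivative Jac F (c y) *v c' y) (at y)"
      if "(t, y) \<in> D" for y
      using has_vector_derivative_Jac_compose[OF c[OF that] D_F(1)] Om[OF that]
      by (simp add: c_def)
    have vd_Fc: "vector_derivative (\<lambda>y. F (\<E> (u t y))) (at y) = Jac F (c y) *v c' y"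
      if "(t, y) \<in> D" for y
      using vector_derivative_at[OF Fc[OF that]] by (simp add: c_def)
    \<comment> \<open>The reduced flux vanishes on the equilibrium manifold, so its space derivative does too.\<close>
    have QFc: "Q *v (Jac F (c y) *v c' y) = 0" if ty: "(t, y) \<in> D" for y
    proof (rule has_vector_derivative_eventually_unique)
      show "((\<lambda>y. Q *v F (c y)) has_vector_derivative Q *v (Jac F (c y) *v c' y)) (at y)"
        by (rule bounded_linear.has_vector_derivative[OF matrix_vector_mul_bounded_linear Fc[OF ty]])
      show "((\<lambda>y. 0) has_vector_derivative 0) (at y)"
        by simp
      show "\<forall>\<^sub>F z in nhds y. Q *v F (c z) = 0"
        using near_x[OF ty] by eventually_elim (use QF om c_def in auto)
    qed
    note corr = corrector_bordered_system[OF rank_Q QL, of R \<E> "u t" _ F]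
    have corr:
      "det (Jac R (c y) + L ** Q) \<noteq> 0"
      "\<exists>!V. corrector_equations F R Q \<E> (u t) y V"
      "(Jac R (c y) + L ** Q) *v ?V y = - (Jac F (c y) *v c' y)"
      "Jac R (c y) *v ?V y = - (Jac F (c y) *v c' y)" if ty: "(t, y) \<in> D" for y
      using corr[of y] QB[OF Om[OF ty]] dim_ker ker_Im om[OF ty] QFc[OF ty] vd_Fc[OF ty]
      by (auto simp: c_def)
    show "\<exists>!V. corrector_equations F R Q \<E> (u t) x V"
      by (rule corr(2)[OF tx])
    have c_diff: "c differentiable (at x)"
      using c[OF tx] by (blast intro: differentiableI_vector)
    have ut_diff: "u t differentiable (at x)"
      using u_x[OF tx] by (blast intro: differentiableI_vector)
    \<comment> \<open>Here the second derivatives of the state enter: the right-hand side of the square system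
      already contains first ones.\<close>
    have c'_diff: "c' differentiable (at x)"
      unfolding c'_def
      by (intro differentiable_matrix_vector_mult ux_diff tx
          differentiable_compose[OF D_E(2) ut_diff] om)
    have Om_x: "c x \<in> \<Omega>"
      using Om[OF tx] by (simp add: c_def)
    have AF_diff: "(\<lambda>y. Jac F (c y)) differentiable (at x)"
      and BR_diff: "(\<lambda>y. Jac R (c y)) differentiable (at x)"
      by (intro differentiable_compose[OF _ c_diff] D_F Om_x)+
    have V_diff: "?V differentiable (at x)"
    proof (rule differentiable_linear_solve)
      show "(\<lambda>y. Jac R (c y) + L ** Q) differentiable (at x)"
        by (intro differentiable_add BR_diff differentiable_const)
      show "(\<lambda>y. - (Jac F (c y) *v c' y)) differentiable (at x)"
        by (intro differentiable_minus differentiable_matrix_vector_mult AF_diff c'_diff)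
      show "\<forall>\<^sub>F y in nhds x. det (Jac R (c y) + L ** Q) \<noteq> 0 \<and>
          (Jac R (c y) + L ** Q) *v ?V y = - (Jac F (c y) *v c' y)"
        using near_x[OF tx] by eventually_elim (use corr in blast)
    qed
    define q' where "q' = vector_derivative (\<lambda>y. Q *v (Jac F (\<E> (u t y)) *v ?V y)) (at x)"
    have "(\<lambda>y. Q *v (Jac F (c y) *v ?V y)) differentiable (at x)"
      by (intro differentiable_matrix_vector_mult differentiable_const AF_diff V_diff)
    then have q: "((\<lambda>y. Q *v (Jac F (c y) *v ?V y)) has_vector_derivative q') (at x)"
      by (simp add: vector_derivative_works q'_def c_def)
    have u_t_eq: "ut t x = - q'"
      using limiting_system tx vector_derivative_at[OF u_t[OF tx]] by (auto simp: q'_def)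
    have flux: "((\<lambda>y. grad \<Phi> (c y) \<bullet> (Jac F (c y) *v ?V y)) has_field_derivative
        \<nu> (c x) \<bullet> q' + (hessian \<Phi> (c x) *v c' x) \<bullet> (Jac F (c x) *v ?V x)) (at x)"
    proof (rule multiplier_product_rule[OF QL c[OF tx] _ _ q])
      show "grad \<Phi> differentiable (at (c x))"
        by (rule D_F(4)[OF Om_x])
      show "\<forall>\<^sub>F y in nhds x. grad \<Phi> (c y) = \<nu> (c y) v* Q"
        using near_x[OF tx] by eventually_elim (use nu om c_def in auto)
    qed
    have H_sym: "transpose (hessian \<Phi> (c x)) = hessian \<Phi> (c x)"
      using entropy_convex Om_x by (auto simp: positive_definite_def)
    have "(hessian \<Phi> (c x) *v c' x) \<bullet> (Jac F (c x) *v ?V x) =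
        (hessian \<Phi> (c x) *v (Jac F (c x) *v c' x)) \<bullet> ?V x"
      using symmetrizer_swap[OF H_sym] entropy_sym Om_x by blast
    also have "\<dots> = - ((hessian \<Phi> (c x) *v (Jac R (c x) *v ?V x)) \<bullet> ?V x)"
      by (simp add: corr(4)[OF tx] vec.neg)
    also have "\<dots> = - ((hessian \<Phi> (c x) *v ?V x) \<bullet> (Jac R (c x) *v ?V x))"
      using inner_symmetric_matrix[OF H_sym] by (simp add: inner_commute)
    finally have production: "(hessian \<Phi> (c x) *v c' x) \<bullet> (Jac F (c x) *v ?V x) =
        - ((hessian \<Phi> (c x) *v ?V x) \<bullet> (Jac R (c x) *v ?V x))" .
    have nonneg: "(hessian \<Phi> (c x) *v ?V x) \<bullet> (Jac R (c x) *v ?V x) \<ge> 0"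
    proof (rule hessian_dissipation_nonneg[OF Omega(1) Om_x])
      show "grad \<Phi> (c x) = \<nu> (c x) v* Q" "R (c x) = 0"
        using nu equilibria om[OF tx] by (auto simp: c_def)
    qed (use dissipation QR D_F Om_x in auto)
    have "\<forall>\<^sub>F y in nhds x. grad \<Phi> (c y) \<bullet> (Jac F (c y) *v ?V y) = grad \<Psi> (c y) \<bullet> ?V y"
      using near_x[OF tx]
    proof eventually_elim
      case (elim y)
      then show ?case
        using entropy_flux Om[OF elim] by (metis c_def dot_lmul_matrix)
    qed
    from has_derivative_eventually_eq[OF flux[unfolded has_field_derivative_def] this] production
    have flux': "((\<lambda>y. grad \<Psi> (\<E> (u t y)) \<bullet> ?V y) has_field_derivative
        \<nu> (c x) \<bullet> q' - (hessian \<Phi> (c x) *v ?V x) \<bullet> (Jac R (c x) *v ?V x)) (at x)"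
      by (simp add: has_field_derivative_def c_def)
    then show "(\<lambda>y. grad \<Psi> (\<E> (u t y)) \<bullet> ?V y) differentiable (at x)"
      using real_differentiable_def by blast
    define e' where "e' = Jac \<E> (u t x) *v ut t x"
    have e: "((\<lambda>s. \<E> (u s x)) has_vector_derivative e') (at t)"
      unfolding e'_def by (rule has_vector_derivative_Jac_compose[OF u_t[OF tx] D_E(1)[OF om[OF tx]]])
    \<comment> \<open>Differentiating \<open>Q \<E>(u) = u\<close> in time along the solution.\<close>
    have Qe': "Q *v e' = ut t x"
    proof (rule has_vector_derivative_eventually_unique)
      show "((\<lambda>s. Q *v \<E> (u s x)) has_vector_derivative Q *v e') (at t)"
        by (rule bounded_linear.has_vector_derivative[OF matrix_vector_mul_bounded_linear e])
      show "\<forall>\<^sub>F s in nhds t. Q *v \<E> (u s x) = u s x"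
        using near_t by eventually_elim (use equilibria om in blast)
    qed (rule u_t[OF tx])
    have Phi: "((\<lambda>s. \<Phi> (\<E> (u s x))) has_field_derivative grad \<Phi> (c x) \<bullet> e') (at t)"
      using has_field_derivative_grad_compose[OF e D_F(3)[OF Om[OF tx]]] by (simp add: c_def)
    then show "(\<lambda>s. \<Phi> (\<E> (u s x))) differentiable (at t)"
      using real_differentiable_def by blast
    have "grad \<Phi> (c x) \<bullet> e' = \<nu> (c x) \<bullet> (Q *v e')"
      using nu om[OF tx] by (simp add: c_def dot_lmul_matrix)
    also have "\<dots> = - (\<nu> (c x) \<bullet> q')"
      by (simp add: Qe' u_t_eq)
    finally show "deriv (\<lambda>s. \<Phi> (\<E> (u s x))) t \<le> - deriv (\<lambda>y. grad \<Psi> (\<E> (u t y)) \<bullet> ?V y) x"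
      using DERIV_imp_deriv[OF Phi] DERIV_imp_deriv[OF flux'] nonneg by simp
  qed
qed

end
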